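(* Let $\mathcal{H}$ be a real Hilbert space, let $A$ be a closed affine subspace of $\mathcal{H}$, and let $B$ be a proximinal subset of $\mathcal{H}$. Consider the following statements. (a) $P_A(B) \subseteq B$; (b) $P_A(B) = A\cap B$; (c) $P_B(A) \subseteq A$; (d) $P_B(A) = A\cap B$; (e) $P_BP_A = P_{A\cap B}$ (equality of set-valued operators on $\mathcal{H}$). Then (a) $\implies$ (b) $\implies$ (c) $\implies$ (d) $\implies$ (e). Moreover, if $B$ is convex, then all five statements are equivalent.
   Context: For a subset $C$ of $\mathcal{H}$, the projector onto $C$ is the set-valued operator $P_C(x) = \{c\in C : \|x-c\| = \inf_{z\in C}\|x-z\|\}$, $x\in\mathcal{H}$ (so $P_\varnothing(x)=\varnothing$). When $P_C(x)$ is always a singleton (e.g. $C$ nonempty, closed and convex), $P_C$ is regarded as a single-valued map. The set $C$ is proximinal if it is nonempty and $P_C(x)\neq\varnothing$ for every $x\in\mathcal{H}$. Affine subspaces are nonempty. For a set-valued operator $P$ and a set $K$, $P(K) = \bigcup_{x\in K}P(x)$, and $P_BP_A$ denotes the composition $P_BP_A(x) = P_B(P_A(x))$. *)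

theory Defs
  imports "HOL-Analysis.Analysis"
begin

text \<open>
  The projector is set-valued, with no selection of a nearest point (unlike
  \<^const>\<open>closest_point\<close>).  For \<open>C = {}\<close> the infimum is unspecified,
  but the value is \<open>{}\<close> because of the conjunct \<open>c \<in> C\<close>.
\<close>

definition proj :: "'a::real_normed_vector set \<Rightarrow> 'a \<Rightarrow> 'a set" where
  "proj C x = {c \<in> C. norm (x - c) = (INF z\<in>C. norm (x - z))}"

definition proximinal :: "'a::real_normed_vector set \<Rightarrow> bool" where
  "proximinal C \<longleftrightarrow> C \<noteq> {} \<and> (\<forall>x. proj C x \<noteq> {})"

definition sv_image :: "('a \<Rightarrow> 'b set) \<Rightarrow> 'a set \<Rightarrow> 'b set" where
  "sv_image P K = (\<Union>x\<in>K. P x)"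

definition sv_comp :: "('b \<Rightarrow> 'c set) \<Rightarrow> ('a \<Rightarrow> 'b set) \<Rightarrow> 'a \<Rightarrow> 'c set" where
  "sv_comp Q P = (\<lambda>x. sv_image Q (P x))"

text \<open>The library predicate \<^const>\<open>affine\<close> holds of the empty set; affine subspaces do not.\<close>

definition affine_subspace :: "'a::real_vector set \<Rightarrow> bool" where
  "affine_subspace A \<longleftrightarrow> affine A \<and> A \<noteq> {}"

end

theory Submission
  imports Defs
begin

text \<open>
  Write \<open>p\<close> for the nearest point of \<open>x\<close> in \<open>A\<close>. Since \<open>A\<close> is affine, \<open>x - p\<close> is orthogonal to
  every direction of \<open>A\<close>, so that
  \<open>\<parallel>x - a\<parallel>\<^sup>2 = \<parallel>x - p\<parallel>\<^sup>2 + \<parallel>p - a\<parallel>\<^sup>2\<close> for all \<open>a \<in> A\<close>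
  (\<open>proj_affine_pythagoras\<close>). This identity carries the whole theorem.

  A nearest-point operator fixes the points of its own set, so \<open>P\<^sub>C(K) \<subseteq> K\<close> is the same as
  \<open>P\<^sub>C(K) = C \<inter> K\<close> for arbitrary \<open>C\<close> and \<open>K\<close>; this makes (a) and (b) equivalent, and likewise (c)
  and (d). It remains to relate (a), (c) and (e).

  For (a) \<open>\<Longrightarrow>\<close> (c), let \<open>b\<close> be a point of \<open>B\<close> nearest to \<open>a \<in> A\<close>. By the identity, moving \<open>b\<close> to
  \<open>P\<^sub>A(b)\<close>, which is still in \<open>B\<close>, brings it strictly closer to \<open>a\<close> unless \<open>b \<in> A\<close> already.
  For (c) \<open>\<Longrightarrow>\<close> (e), the points of \<open>B\<close> nearest to \<open>p\<close> lie in \<open>A\<close>, hence they are the points of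
  \<open>A \<inter> B\<close> nearest to \<open>p\<close>; and \<open>x\<close> and \<open>p\<close> have the same nearest points in any subset of \<open>A\<close>, because
  their squared distances to a point of \<open>A\<close> differ by a constant. Conversely, (e) restricted to \<open>A\<close>,
  where \<open>P\<^sub>A\<close> is the identity, says that \<open>P\<^sub>B\<close> and the projector onto \<open>A \<inter> B\<close> agree on \<open>A\<close>, which
  gives (c).

  Convexity of \<open>B\<close> yields (c) \<open>\<Longrightarrow>\<close> (a). For \<open>b \<in> B\<close>, \<open>p = P\<^sub>A(b)\<close> and \<open>q \<in> P\<^sub>B(p) \<subseteq> A\<close>, the
  obtuse-angle inequality for the nearest point \<open>q\<close> of a convex set gives \<open>(p - q) \<bullet> (b - q) \<le> 0\<close>,
  while \<open>b - p\<close> is orthogonal to \<open>p - q\<close>, so the left-hand side is \<open>\<parallel>p - q\<parallel>\<^sup>2\<close>. Hence \<open>p = q \<in> B\<close>.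
\<close>

section \<open>Nearest points in arbitrary sets\<close>

lemma mem_proj_iff: "c \<in> proj C x \<longleftrightarrow> c \<in> C \<and> (\<forall>z\<in>C. norm (x - c) \<le> norm (x - z))"
proof -
  have bdd: "bdd_below ((\<lambda>z. norm (x - z)) ` C)"
    by (rule bdd_belowI2[where m = 0]) simp
  show ?thesis
  proof (intro iffI conjI ballI)
    assume "c \<in> proj C x"
    then show "c \<in> C" and "\<And>z. z \<in> C \<Longrightarrow> norm (x - c) \<le> norm (x - z)"
      using cINF_lower[OF bdd] by (auto simp: proj_def)
  next
    assume c: "c \<in> C \<and> (\<forall>z\<in>C. norm (x - c) \<le> norm (x - z))"
    then have "norm (x - c) \<le> (INF z\<in>C. norm (x - z))"
      by (intro cINF_greatest) auto
    moreover have "(INF z\<in>C. norm (x - z)) \<le> norm (x - c)"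
      using c by (intro cINF_lower[OF bdd]) simp
    ultimately show "c \<in> proj C x"
      using c by (simp add: proj_def)
  qed
qed

lemma proj_of_mem: "x \<in> C \<Longrightarrow> proj C x = {x}"
  by (force simp: mem_proj_iff)

lemma sv_image_proj_subset_iff: "sv_image (proj C) K \<subseteq> K \<longleftrightarrow> sv_image (proj C) K = C \<inter> K"
proof -
  have "sv_image (proj C) K \<subseteq> C"
    by (auto simp: sv_image_def mem_proj_iff)
  moreover have "C \<inter> K \<subseteq> sv_image (proj C) K"
    using proj_of_mem by (fastforce simp: sv_image_def)
  ultimately show ?thesis by blast
qed

text \<open>If one minimiser over \<open>B\<close> lies in \<open>A\<close>, then \<open>B\<close> and \<open>A \<inter> B\<close> have the same distance to \<open>x\<close>.\<close>
lemma proj_eq_proj_Int: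
  assumes "proj B x \<subseteq> A" and "proj B x \<noteq> {}"
  shows "proj B x = proj (A \<inter> B) x"
proof -
  obtain q where q: "q \<in> proj B x" "q \<in> A"
    using assms by blast
  have "norm (x - c) \<le> norm (x - z)" if "c \<in> proj (A \<inter> B) x" "z \<in> B" for c z
  proof (rule order_trans)
    show "norm (x - c) \<le> norm (x - q)"
      using that(1) q by (simp add: mem_proj_iff)
    show "norm (x - q) \<le> norm (x - z)"
      using that(2) q by (simp add: mem_proj_iff)
  qed
  then show ?thesis
    using assms(1) by (auto simp: mem_proj_iff)
qed

section \<open>Nearest points in convex sets\<close>

text \<open>
  Otherwise a short step from \<open>c\<close> towards \<open>z\<close>, which stays in \<open>C\<close>, would come closer to \<open>x\<close>:
  the squared distance at \<open>c + t(z - c)\<close> changes by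
  \<open>- 2t (x - c) \<bullet> (z - c) + t\<^sup>2 \<parallel>z - c\<parallel>\<^sup>2\<close>.
\<close>
lemma proj_convex_obtuse:
  fixes C :: "'a::real_inner set"
  assumes "convex C" and c: "c \<in> proj C x" and "z \<in> C"
  shows "(x - c) \<bullet> (z - c) \<le> 0"
proof (rule ccontr)
  define s where "s = (x - c) \<bullet> (z - c)"
  define n where "n = (norm (z - c))\<^sup>2"
  have step: "2 * s \<le> t * n" if t: "0 < t" "t \<le> 1" for t
  proof -
    have "c + t *\<^sub>R (z - c) = (1 - t) *\<^sub>R c + t *\<^sub>R z"
      by (simp add: algebra_simps)
    then have "c + t *\<^sub>R (z - c) \<in> C"
      using assms t by (simp add: mem_proj_iff convexD)
    then have "(norm (x - c))\<^sup>2 \<le> (norm (x - (c + t *\<^sub>R (z - c))))\<^sup>2"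
      using c by (simp add: mem_proj_iff power_mono)
    also have "x - (c + t *\<^sub>R (z - c)) = (x - c) - t *\<^sub>R (z - c)"
      by simp
    also have "(norm \<dots>)\<^sup>2 = (norm (x - c))\<^sup>2 - 2 * t * s + t\<^sup>2 * n"
      unfolding s_def n_def power2_norm_eq_inner
      by (simp only: inner_diff_left inner_diff_right inner_scaleR_left inner_scaleR_right)
         (simp add: inner_commute power2_eq_square algebra_simps)
    finally have "t * (2 * s) \<le> t * (t * n)"
      by (simp add: power2_eq_square algebra_simps)
    then show ?thesis
      using t by simp
  qed
  assume "\<not> (x - c) \<bullet> (z - c) \<le> 0"
  then have s: "0 < s"
    by (simp add: s_def)
  moreover have "2 * s \<le> n"
    using step[of 1] by simp
  \<comment> \<open>The step size \<open>s / n\<close> minimises the quadratic; it is at most \<open>1/2\<close> by the case \<open>t = 1\<close>.\<close>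
  ultimately show False
    using step[of "s / n"] by simp
qed

text \<open>
  The points of \<open>S\<close> whose squared distance to \<open>x\<close> is within \<open>1/(n+1)\<close> of the infimum form a
  decreasing sequence of nonempty closed sets. By the parallelogram law, and because midpoints stay
  in \<open>S\<close>, two such points are at squared distance at most \<open>4/(n+1)\<close>, so completeness yields a common
  point of these sets.
\<close>
lemma proj_closed_convex_nonempty:
  fixes S :: "'a::{real_inner,complete_space} set"
  assumes "convex S" and "closed S" and "S \<noteq> {}"
  shows "proj S x \<noteq> {}"
proof -
  define d where "d = (INF z\<in>S. norm (x - z))"
  define F where "F n = {z \<in> S. (norm (x - z))\<^sup>2 \<le> d\<^sup>2 + 1 / real (Suc n)}" for n
  have bdd: "bdd_below ((\<lambda>z. norm (x - z)) ` S)"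
    by (rule bdd_belowI2[where m = 0]) simp
  have d_le: "d \<le> norm (x - z)" if "z \<in> S" for z
    unfolding d_def using that by (intro cINF_lower[OF bdd])
  have d0: "0 \<le> d"
    unfolding d_def using assms(3) by (intro cINF_greatest) auto
  have "closed (F n)" for n
  proof -
    have "F n = S \<inter> {z. (norm (x - z))\<^sup>2 \<le> d\<^sup>2 + 1 / real (Suc n)}"
      by (auto simp: F_def)
    then show ?thesis
      using assms(2) by (simp only:) (intro closed_Int closed_Collect_le continuous_intros)
  qed
  moreover have "F n \<noteq> {}" for n
  proof -
    have "d < sqrt (d\<^sup>2 + 1 / real (Suc n))"
      by (rule real_less_rsqrt) simp
    then obtain z where z: "z \<in> S" "norm (x - z) < sqrt (d\<^sup>2 + 1 / real (Suc n))"
      unfolding d_def using cINF_less_iff[OF assms(3) bdd] by blast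
    then have "(norm (x - z))\<^sup>2 \<le> (sqrt (d\<^sup>2 + 1 / real (Suc n)))\<^sup>2"
      by (intro power_mono) auto
    also have "\<dots> = d\<^sup>2 + 1 / real (Suc n)"
      by simp
    finally show ?thesis
      using z(1) by (auto simp: F_def)
  qed
  moreover have "F n \<subseteq> F m" if "m \<le> n" for m n
  proof -
    have "1 / real (Suc n) \<le> 1 / real (Suc m)"
      using that by (intro divide_left_mono) auto
    then show ?thesis
      unfolding F_def by fastforce
  qed
  moreover have "\<exists>n. \<forall>z\<in>F n. \<forall>w\<in>F n. dist z w < e" if e: "0 < e" for e
  proof -
    obtain n where n: "inverse (real (Suc n)) < e\<^sup>2 / 4"
      using reals_Archimedean[of "e\<^sup>2 / 4"] e by auto
    have "dist z w < e" if zw: "z \<in> F n" "w \<in> F n" for z w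
    proof -
      have "midpoint z w \<in> S"
        using zw assms(1) convexD[of S z w "1/2" "1/2"]
        by (simp add: F_def midpoint_def algebra_simps)
      then have "d\<^sup>2 \<le> (norm (x - midpoint z w))\<^sup>2"
        using d_le d0 by (intro power_mono)
      moreover have "(dist z w)\<^sup>2 =
          2 * (norm (x - z))\<^sup>2 + 2 * (norm (x - w))\<^sup>2 - 4 * (norm (x - midpoint z w))\<^sup>2"
        unfolding dist_norm power2_norm_eq_inner midpoint_def
        by (simp add: inner_diff_left inner_diff_right inner_add_left inner_add_right
            inner_commute algebra_simps)
      moreover have "1 / real (Suc n) < e\<^sup>2 / 4"
        using n by (simp add: divide_simps)
      ultimately have "(dist z w)\<^sup>2 < e\<^sup>2"
        using zw unfolding F_def by simp
      then show ?thesis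
        using e by (simp add: power2_less_imp_less)
    qed
    then show ?thesis by blast
  qed
  ultimately obtain p where p: "\<And>n. p \<in> F n"
    using decreasing_closed_nest[of F] by blast
  have "(norm (x - p))\<^sup>2 \<le> d\<^sup>2"
  proof (rule field_le_epsilon)
    fix e :: real
    assume "0 < e"
    then obtain n where "inverse (real (Suc n)) < e"
      using reals_Archimedean by blast
    then show "(norm (x - p))\<^sup>2 \<le> d\<^sup>2 + e"
      using p[of n] unfolding F_def by (simp add: inverse_eq_divide)
  qed
  then have "norm (x - p) \<le> d"
    using d0 by (rule power2_le_imp_le)
  then have "p \<in> proj S x"
    using p[of 0] d_le by (fastforce simp: mem_proj_iff F_def)
  then show ?thesis by blast
qed

section \<open>Nearest points in affine subspaces\<close>

text \<open>
  An affine set contains, with \<open>a\<close>, the reflection \<open>2p - a\<close> of \<open>a\<close> in \<open>p\<close>. The obtuse-angle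
  inequality for both points leaves only a right angle.
\<close>
lemma proj_affine_orthogonal:
  fixes A :: "'a::real_inner set"
  assumes "affine A" and p: "p \<in> proj A x" and "a \<in> A"
  shows "(x - p) \<bullet> (a - p) = 0"
proof -
  have "2 *\<^sub>R p + (-1) *\<^sub>R a \<in> A"
    using assms by (intro mem_affine) (simp_all add: mem_proj_iff)
  moreover have "2 *\<^sub>R p + (-1) *\<^sub>R a - p = - (a - p)"
    by (simp add: scaleR_2)
  ultimately have "(x - p) \<bullet> (- (a - p)) \<le> 0"
    using proj_convex_obtuse[OF affine_imp_convex[OF assms(1)] p] by metis
  moreover have "(x - p) \<bullet> (a - p) \<le> 0"
    using proj_convex_obtuse[OF affine_imp_convex[OF assms(1)] p assms(3)] .
  ultimately show ?thesis
    unfolding inner_minus_right by linarith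
qed

lemma proj_affine_pythagoras:
  fixes A :: "'a::real_inner set"
  assumes "affine A" and "p \<in> proj A x" and "a \<in> A"
  shows "(norm (x - a))\<^sup>2 = (norm (x - p))\<^sup>2 + (norm (p - a))\<^sup>2"
proof -
  have "orthogonal (x - p) (p - a)"
    using proj_affine_orthogonal[OF assms] by (simp add: orthogonal_def inner_diff_right)
  then show ?thesis
    using norm_add_Pythagorean[of "x - p" "p - a"] by simp
qed

lemma proj_affine_unique:
  fixes A :: "'a::real_inner set"
  assumes "affine A" and p: "p \<in> proj A x"
  shows "proj A x = {p}"
proof -
  have "q = p" if "q \<in> proj A x" for q
  proof -
    have "q \<in> A" and "norm (x - q) \<le> norm (x - p)"
      using that p by (simp_all add: mem_proj_iff)
    then have "(norm (x - p))\<^sup>2 + (norm (p - q))\<^sup>2 \<le> (norm (x - p))\<^sup>2"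
      using proj_affine_pythagoras[OF assms, of q] power_mono[of "norm (x - q)" "norm (x - p)" 2]
      by simp
    then show ?thesis by simp
  qed
  then show ?thesis using p by blast
qed

text \<open>On \<open>A\<close>, the squared distances to \<open>x\<close> and to \<open>p\<close> differ by the constant \<open>\<parallel>x - p\<parallel>\<^sup>2\<close>.\<close>
lemma proj_subset_affine:
  fixes A :: "'a::real_inner set"
  assumes "affine A" and "p \<in> proj A x" and "D \<subseteq> A"
  shows "proj D x = proj D p"
proof -
  have "norm (x - c) \<le> norm (x - z) \<longleftrightarrow> norm (p - c) \<le> norm (p - z)"
    if "c \<in> A" "z \<in> A" for c z
  proof -
    have "(norm (x - c))\<^sup>2 \<le> (norm (x - z))\<^sup>2 \<longleftrightarrow> (norm (p - c))\<^sup>2 \<le> (norm (p - z))\<^sup>2"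
      using that proj_affine_pythagoras[OF assms(1,2)] by simp
    then show ?thesis
      by (simp only: power_mono_iff norm_ge_zero zero_less_numeral)
  qed
  then show ?thesis
    using assms(3) by (auto simp: mem_proj_iff subset_iff)
qed

section \<open>Projecting one set onto the other\<close>

text \<open>
  A point \<open>b \<in> B\<close> nearest to \<open>y \<in> A\<close> competes with its own projection onto \<open>A\<close>, and by Pythagoras it
  can only win if the two coincide.
\<close>
lemma proj_image_into_affine:
  fixes A B :: "'a::{real_inner,complete_space} set"
  assumes A: "affine A" "closed A" "A \<noteq> {}" and a: "sv_image (proj A) B \<subseteq> B"
  shows "sv_image (proj B) A \<subseteq> A"
proof
  fix b assume "b \<in> sv_image (proj B) A"
  then obtain y where y: "y \<in> A" and b: "b \<in> proj B y"
    by (auto simp: sv_image_def)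
  obtain p where p: "p \<in> proj A b"
    using proj_closed_convex_nonempty[OF affine_imp_convex] A by blast
  moreover have "b \<in> B"
    using b by (simp add: mem_proj_iff)
  ultimately have "p \<in> B"
    using a unfolding sv_image_def by blast
  then have "norm (b - y) \<le> norm (p - y)"
    using b by (simp add: mem_proj_iff norm_minus_commute)
  then have "(norm (b - y))\<^sup>2 \<le> (norm (p - y))\<^sup>2"
    by (simp add: power_mono)
  then have "b = p"
    using proj_affine_pythagoras[OF A(1) p y] by simp
  then show "b \<in> A"
    using p by (simp add: mem_proj_iff)
qed

text \<open>
  For \<open>p\<close> nearest to \<open>b\<close> in \<open>A\<close> and \<open>q\<close> nearest to \<open>p\<close> in \<open>B\<close>, the triangle \<open>b, p, q\<close> has a right
  angle at \<open>p\<close>, as \<open>q \<in> A\<close>, and an angle of at least \<open>90\<close> degrees at \<open>q\<close>, as \<open>B\<close> is convex; so it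
  degenerates to \<open>p = q\<close>.
\<close>
lemma proj_image_into_convex:
  fixes A B :: "'a::real_inner set"
  assumes "affine A" "convex B" "proximinal B" and c: "sv_image (proj B) A \<subseteq> A"
  shows "sv_image (proj A) B \<subseteq> B"
proof
  fix p assume "p \<in> sv_image (proj A) B"
  then obtain b where b: "b \<in> B" and p: "p \<in> proj A b"
    by (auto simp: sv_image_def)
  obtain q where q: "q \<in> proj B p"
    using assms(3) by (auto simp: proximinal_def)
  have "p \<in> A"
    using p by (simp add: mem_proj_iff)
  then have "q \<in> A"
    using q c unfolding sv_image_def by blast
  then have "(b - p) \<bullet> (q - p) = 0"
    by (rule proj_affine_orthogonal[OF assms(1) p])
  then have "(p - q) \<bullet> (p - q) = (p - q) \<bullet> (b - q)"
    by (simp add: inner_diff_left inner_diff_right inner_commute)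
  also have "\<dots> \<le> 0"
    by (rule proj_convex_obtuse[OF assms(2) q b])
  finally have "p = q"
    by (simp flip: power2_norm_eq_inner)
  then show "p \<in> B"
    using q by (simp add: mem_proj_iff)
qed

lemma proj_composition_iff:
  fixes A B :: "'a::{real_inner,complete_space} set"
  assumes A: "affine A" "closed A" "A \<noteq> {}" and B: "proximinal B"
  shows "sv_comp (proj B) (proj A) = proj (A \<inter> B) \<longleftrightarrow> sv_image (proj B) A \<subseteq> A"
proof
  assume c: "sv_image (proj B) A \<subseteq> A"
  show "sv_comp (proj B) (proj A) = proj (A \<inter> B)"
  proof
    fix x
    obtain p where p: "p \<in> proj A x"
      using proj_closed_convex_nonempty[OF affine_imp_convex] A by blast
    have "sv_comp (proj B) (proj A) x = proj B p"
      by (simp add: sv_comp_def sv_image_def proj_affine_unique[OF A(1) p])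
    also have "\<dots> = proj (A \<inter> B) p"
      using c p B by (intro proj_eq_proj_Int) (auto simp: sv_image_def mem_proj_iff proximinal_def)
    also have "\<dots> = proj (A \<inter> B) x"
      by (rule proj_subset_affine[OF A(1) p, symmetric]) simp
    finally show "sv_comp (proj B) (proj A) x = proj (A \<inter> B) x" .
  qed
next
  assume e: "sv_comp (proj B) (proj A) = proj (A \<inter> B)"
  have "proj B x = proj (A \<inter> B) x" if "x \<in> A" for x
    using fun_cong[OF e, of x] that by (simp add: sv_comp_def sv_image_def proj_of_mem)
  then show "sv_image (proj B) A \<subseteq> A"
    by (auto simp: sv_image_def mem_proj_iff)
qed

theorem theorem3p1:
  fixes A B :: "'h::{real_inner,complete_space} set"
  assumes "affine_subspace A" and "closed A" and "proximinal B"
  shows "(let a = (sv_image (proj A) B \<subseteq> B);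
              b = (sv_image (proj A) B = A \<inter> B);
              c = (sv_image (proj B) A \<subseteq> A);
              d = (sv_image (proj B) A = A \<inter> B);
              e = (sv_comp (proj B) (proj A) = proj (A \<inter> B))
          in (a \<longrightarrow> b) \<and> (b \<longrightarrow> c) \<and> (c \<longrightarrow> d) \<and> (d \<longrightarrow> e) \<and>
             (convex B \<longrightarrow> (a \<longleftrightarrow> b) \<and> (b \<longleftrightarrow> c) \<and> (c \<longleftrightarrow> d) \<and> (d \<longleftrightarrow> e)))"
proof -
  have A: "affine A" "A \<noteq> {}"
    using assms(1) by (simp_all add: affine_subspace_def)
  have ab: "sv_image (proj A) B \<subseteq> B \<longleftrightarrow> sv_image (proj A) B = A \<inter> B"
    by (rule sv_image_proj_subset_iff)
  have cd: "sv_image (proj B) A \<subseteq> A \<longleftrightarrow> sv_image (proj B) A = A \<inter> B"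
    using sv_image_proj_subset_iff[of B A] by (simp only: Int_commute)
  have ac: "sv_image (proj A) B \<subseteq> B \<Longrightarrow> sv_image (proj B) A \<subseteq> A"
    by (rule proj_image_into_affine[OF A(1) assms(2) A(2)])
  have ca: "convex B \<Longrightarrow> sv_image (proj B) A \<subseteq> A \<Longrightarrow> sv_image (proj A) B \<subseteq> B"
    by (rule proj_image_into_convex[OF A(1) _ assms(3)])
  have ec: "sv_comp (proj B) (proj A) = proj (A \<inter> B) \<longleftrightarrow> sv_image (proj B) A \<subseteq> A"
    by (rule proj_composition_iff[OF A(1) assms(2) A(2) assms(3)])
  show ?thesis
    unfolding Let_def using ab cd ac ca ec by argo
qed

end
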